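(* Let $G$ be a compact group with normalized Haar measure $\nu$ and FC-center $F$. Then the following conditions are equivalent: (1) $(\nu\times\nu)(\{(x,y)\in G\times G : [x,y]=1\})>0$. (2) $F$ is open in $G$. (3) The center $Z(F)$ of $F$ is open in $G$.
   Context: Compact groups are Hausdorff topological groups. The FC-center of $G$ is the subgroup $F=\{x\in G : \text{the conjugacy class of } x \text{ in } G \text{ is finite}\}$. $[x,y]$ denotes the commutator of $x$ and $y$. $\nu\times\nu$ denotes the product measure on $G\times G$, i.e. the normalized Haar measure of the compact group $G\times G$. *)

theory Defs
  imports "HOL-Analysis.Analysis" "HOL-Algebra.Coset"
begin

subsection \<open>Compact groups\<close>

locale compact_group = group G for G (structure) +
  fixes T :: "'a topology"
  assumes topspace_eq: "topspace T = carrier G"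
    and continuous_mult: "continuous_map (prod_topology T T) T (\<lambda>(x, y). x \<otimes> y)"
    and continuous_inv: "continuous_map T T (\<lambda>x. inv x)"
    and compact: "compact_space T"
    and Hausdorff: "Hausdorff_space T"


subsection \<open>Haar measure\<close>

definition regular_borel_measure :: "'a topology \<Rightarrow> 'a measure \<Rightarrow> bool" where
  "regular_borel_measure T M \<longleftrightarrow>
     sets M = sigma_sets (topspace T) {U. openin T U} \<and>
     (\<forall>K. compactin T K \<longrightarrow> emeasure M K < \<infinity>) \<and>
     (\<forall>A\<in>sets M. emeasure M A = (INF U\<in>{U. openin T U \<and> A \<subseteq> U}. emeasure M U)) \<and>
     (\<forall>U. openin T U \<longrightarrow> emeasure M U = (SUP K\<in>{K. compactin T K \<and> K \<subseteq> U}. emeasure M K))"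

definition normalized_haar_measure ::
    "('a, 'b) monoid_scheme \<Rightarrow> 'a topology \<Rightarrow> 'a measure \<Rightarrow> bool" where
  "normalized_haar_measure G T M \<longleftrightarrow>
     regular_borel_measure T M \<and>
     emeasure M (carrier G) = 1 \<and>
     (\<forall>g\<in>carrier G. \<forall>A\<in>sets M. emeasure M (g <#\<^bsub>G\<^esub> A) = emeasure M A)"

text \<open>
  If \<open>T\<close> is not second countable, the Borel sets of the product topology (for instance the closed
  set of commuting pairs) need not belong to the product \<open>\<sigma>\<close>-algebra on which the library's
  \<open>M1 \<Otimes>\<^sub>M M2\<close> lives. The product measure is therefore the regular Borel measure on the product
  space with the product values on rectangles. Such a measure is unique, and for Haar measures it
  is the Haar measure of the product group: see \<open>radon_product_measure_unique\<close> and
  \<open>normalized_haar_measure_product\<close> below.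
\<close>

definition radon_product_measure ::
    "'a topology \<Rightarrow> 'a measure \<Rightarrow> 'b topology \<Rightarrow> 'b measure \<Rightarrow> ('a \<times> 'b) measure \<Rightarrow> bool" where
  "radon_product_measure S M T N P \<longleftrightarrow>
     regular_borel_measure (prod_topology S T) P \<and>
     (\<forall>A\<in>sets M. \<forall>B\<in>sets N. emeasure P (A \<times> B) = emeasure M A * emeasure N B)"


subsection \<open>FC-center, center and commutator\<close>

definition conjugacy_class :: "('a, 'b) monoid_scheme \<Rightarrow> 'a \<Rightarrow> 'a set" where
  "conjugacy_class G x = (\<lambda>g. g \<otimes>\<^bsub>G\<^esub> x \<otimes>\<^bsub>G\<^esub> inv\<^bsub>G\<^esub> g) ` carrier G"

definition FC_center :: "('a, 'b) monoid_scheme \<Rightarrow> 'a set" where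
  "FC_center G = {x \<in> carrier G. finite (conjugacy_class G x)}"

definition center :: "('a, 'b) monoid_scheme \<Rightarrow> 'a set" where
  "center G = {z \<in> carrier G. \<forall>x\<in>carrier G. z \<otimes>\<^bsub>G\<^esub> x = x \<otimes>\<^bsub>G\<^esub> z}"

definition commutator :: "('a, 'b) monoid_scheme \<Rightarrow> 'a \<Rightarrow> 'a \<Rightarrow> 'a" where
  "commutator G x y = x \<otimes>\<^bsub>G\<^esub> y \<otimes>\<^bsub>G\<^esub> inv\<^bsub>G\<^esub> x \<otimes>\<^bsub>G\<^esub> inv\<^bsub>G\<^esub> y"

lemma (in group) subgroup_FC_center: "subgroup (FC_center G) G"
proof (rule subgroupI)
  show "FC_center G \<subseteq> carrier G" by (auto simp: FC_center_def)
  have "conjugacy_class G \<one> \<subseteq> {\<one>}" by (auto simp: conjugacy_class_def)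
  then have "\<one> \<in> FC_center G" by (auto simp: FC_center_def intro: finite_subset)
  then show "FC_center G \<noteq> {}" by blast
next
  fix a assume a: "a \<in> FC_center G"
  then have ac: "a \<in> carrier G" by (auto simp: FC_center_def)
  have "conjugacy_class G (inv a) = (\<lambda>x. inv x) ` conjugacy_class G a"
    unfolding conjugacy_class_def image_image
    by (rule image_cong) (use ac in \<open>auto simp: inv_mult_group m_assoc\<close>)
  then show "inv a \<in> FC_center G" using a ac by (auto simp: FC_center_def)
next
  fix a b assume a: "a \<in> FC_center G" and b: "b \<in> FC_center G"
  then have ac: "a \<in> carrier G" "b \<in> carrier G" by (auto simp: FC_center_def)
  have eq: "g \<otimes> (a \<otimes> b) \<otimes> inv g = (g \<otimes> a \<otimes> inv g) \<otimes> (g \<otimes> b \<otimes> inv g)"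
    if "g \<in> carrier G" for g
  proof -
    have "inv g \<otimes> (g \<otimes> (b \<otimes> inv g)) = b \<otimes> inv g"
      using that ac by (simp add: m_assoc[symmetric])
    then show ?thesis using that ac by (simp add: m_assoc)
  qed
  have "conjugacy_class G (a \<otimes> b) \<subseteq>
      (\<lambda>(x, y). x \<otimes> y) ` (conjugacy_class G a \<times> conjugacy_class G b)"
    using eq unfolding conjugacy_class_def by fastforce
  moreover have "finite ((\<lambda>(x, y). x \<otimes> y) ` (conjugacy_class G a \<times> conjugacy_class G b))"
    using a b by (auto simp: FC_center_def)
  ultimately show "a \<otimes> b \<in> FC_center G"
    using ac by (auto simp: FC_center_def intro: finite_subset)
qed


subsection \<open>The product of Haar measures is the Haar measure of the product group\<close>

lemma regular_borel_measureD:
  assumes "regular_borel_measure T M"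
  shows "sets M = sigma_sets (topspace T) {U. openin T U}"
    and "space M = topspace T"
    and "\<And>U. openin T U \<Longrightarrow> U \<in> sets M"
proof -
  show s: "sets M = sigma_sets (topspace T) {U. openin T U}"
    using assms by (simp add: regular_borel_measure_def)
  have "sets M = sets (sigma (topspace T) {U. openin T U})"
    using s by (subst sets_measure_of) (auto dest: openin_subset)
  then have "space M = space (sigma (topspace T) {U. openin T U})"
    by (rule sets_eq_imp_space_eq)
  then show "space M = topspace T"
    by (subst (asm) space_measure_of) (auto dest: openin_subset)
  show "\<And>U. openin T U \<Longrightarrow> U \<in> sets M" using s by auto
qed

lemma rectangle_cover:
  assumes "openin (prod_topology S T) U" "compactin (prod_topology S T) K" "K \<subseteq> U"
  obtains W where "finite W" "W \<subseteq> {A \<times> B |A B. openin S A \<and> openin T B}" "K \<subseteq> \<Union>W" "\<Union>W \<subseteq> U"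
proof -
  let ?R = "{A \<times> B |A B. openin S A \<and> openin T B \<and> A \<times> B \<subseteq> U}"
  have "\<And>R. R \<in> ?R \<Longrightarrow> openin (prod_topology S T) R"
    by (auto simp: openin_prod_Times_iff)
  moreover have "K \<subseteq> \<Union>?R"
  proof
    fix p assume "p \<in> K"
    then have "p \<in> U" using assms by auto
    obtain x y where p: "p = (x, y)" by (cases p)
    then obtain A B where "openin S A" "openin T B" "x \<in> A" "y \<in> B" "A \<times> B \<subseteq> U"
      using openin_prod_topology_alt[THEN iffD1, OF assms(1), rule_format, of x y] \<open>p \<in> U\<close>
      by blast
    then show "p \<in> \<Union>?R" using p by blast
  qed
  ultimately obtain F where "finite F" "F \<subseteq> ?R" "K \<subseteq> \<Union>F"
    using compactinD[OF assms(2), of ?R] by auto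
  then show ?thesis by (intro that[of F]) blast+
qed

lemma regular_borel_measure_Times:
  assumes M: "regular_borel_measure S M" and N: "regular_borel_measure T N"
    and P: "regular_borel_measure (prod_topology S T) P"
  shows "(\<lambda>x. x) \<in> P \<rightarrow>\<^sub>M (M \<Otimes>\<^sub>M N)"
    and "A \<in> sets M \<Longrightarrow> B \<in> sets N \<Longrightarrow> A \<times> B \<in> sets P"
proof -
  note M' = regular_borel_measureD[OF M] and N' = regular_borel_measureD[OF N]
    and P' = regular_borel_measureD[OF P]
  have fst: "fst \<in> P \<rightarrow>\<^sub>M M"
  proof (rule measurable_sigma_sets[OF M'(1)])
    show "{U. openin S U} \<subseteq> Pow (topspace S)" by (auto dest: openin_subset)
    show "fst \<in> space P \<rightarrow> topspace S" by (simp add: P'(2) Pi_iff mem_Times_iff)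
    fix U assume "U \<in> {U. openin S U}"
    then have U: "openin S U" by simp
    have "fst -` U \<inter> space P = U \<times> topspace T"
      unfolding P'(2) using openin_subset[OF U] by auto
    also have "openin (prod_topology S T) \<dots>" using U by (simp add: openin_prod_Times_iff)
    finally show "fst -` U \<inter> space P \<in> sets P" by (rule P'(3))
  qed
  have snd: "snd \<in> P \<rightarrow>\<^sub>M N"
  proof (rule measurable_sigma_sets[OF N'(1)])
    show "{U. openin T U} \<subseteq> Pow (topspace T)" by (auto dest: openin_subset)
    show "snd \<in> space P \<rightarrow> topspace T" by (simp add: P'(2) Pi_iff mem_Times_iff)
    fix U assume "U \<in> {U. openin T U}"
    then have U: "openin T U" by simp
    have "snd -` U \<inter> space P = topspace S \<times> U"
      unfolding P'(2) using openin_subset[OF U] by auto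
    also have "openin (prod_topology S T) \<dots>" using U by (simp add: openin_prod_Times_iff)
    finally show "snd -` U \<inter> space P \<in> sets P" by (rule P'(3))
  qed
  show id: "(\<lambda>x. x) \<in> P \<rightarrow>\<^sub>M (M \<Otimes>\<^sub>M N)"
    using measurable_Pair[OF fst snd] by simp
  assume A: "A \<in> sets M" and B: "B \<in> sets N"
  have "(\<lambda>x. x) -` (A \<times> B) \<inter> space P \<in> sets P"
    using A B by (intro measurable_sets[OF id]) simp
  moreover have "A \<times> B \<subseteq> space P"
    using sets.sets_into_space[OF A] sets.sets_into_space[OF B] P'(2) M'(2) N'(2) by auto
  ultimately show "A \<times> B \<in> sets P" by (simp add: Int_absorb2)
qed

lemma radon_product_measure_eq_pair_measure:
  assumes M: "regular_borel_measure S M" "finite_measure M"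
    and N: "regular_borel_measure T N" "finite_measure N"
    and P: "radon_product_measure S M T N P" and V: "V \<in> sets (M \<Otimes>\<^sub>M N)"
  shows "emeasure P V = emeasure (M \<Otimes>\<^sub>M N) V"
proof -
  have rP: "regular_borel_measure (prod_topology S T) P"
    using P by (auto simp: radon_product_measure_def)
  note id = regular_borel_measure_Times(1)[OF M(1) N(1) rP]
  have sP: "space P = space (M \<Otimes>\<^sub>M N)"
    using regular_borel_measureD(2)[OF rP] regular_borel_measureD(2)[OF M(1)]
      regular_borel_measureD(2)[OF N(1)] by (simp add: space_pair_measure)
  have d: "emeasure (distr P (M \<Otimes>\<^sub>M N) (\<lambda>x. x)) W = emeasure P W"
    if "W \<in> sets (M \<Otimes>\<^sub>M N)" for W
    using sets.sets_into_space[OF that] sP by (simp add: emeasure_distr[OF id that] Int_absorb2)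
  have "M \<Otimes>\<^sub>M N = distr P (M \<Otimes>\<^sub>M N) (\<lambda>x. x)"
  proof (rule pair_measure_eqI)
    show "sigma_finite_measure M" "sigma_finite_measure N"
      using M N by (auto simp: finite_measure_def)
    fix A B assume "A \<in> sets M" "B \<in> sets N"
    then show "emeasure M A * emeasure N B = emeasure (distr P (M \<Otimes>\<^sub>M N) (\<lambda>x. x)) (A \<times> B)"
      using P by (simp add: d radon_product_measure_def)
  qed simp
  then show ?thesis using d[OF V] by simp
qed

lemma radon_product_measure_unique:
  assumes M: "regular_borel_measure S M" "finite_measure M"
    and N: "regular_borel_measure T N" "finite_measure N"
    and P: "radon_product_measure S M T N P" and Q: "radon_product_measure S M T N Q"
  shows "P = Q"
proof -
  let ?X = "prod_topology S T"
  have le: "emeasure P U \<le> emeasure Q U"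
    if P: "radon_product_measure S M T N P" and Q: "radon_product_measure S M T N Q"
      and U: "openin ?X U" for P Q U
  proof -
    have rP: "regular_borel_measure ?X P" and rQ: "regular_borel_measure ?X Q"
      using P Q by (auto simp: radon_product_measure_def)
    have "emeasure P K \<le> emeasure Q U" if K: "compactin ?X K" "K \<subseteq> U" for K
    proof -
      obtain W where W: "finite W" "W \<subseteq> {A \<times> B |A B. openin S A \<and> openin T B}"
          "K \<subseteq> \<Union>W" "\<Union>W \<subseteq> U"
        using rectangle_cover[OF U K] .
      have "W \<subseteq> sets (M \<Otimes>\<^sub>M N)"
        using W(2) regular_borel_measureD(3)[OF M(1)] regular_borel_measureD(3)[OF N(1)] by auto
      then have WV: "\<Union>W \<in> sets (M \<Otimes>\<^sub>M N)" using W(1) by auto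
      have oW: "openin ?X (\<Union>W)" using W(2)
        by (intro openin_Union) (auto simp: openin_prod_Times_iff)
      have "emeasure P K \<le> emeasure P (\<Union>W)"
        using W(3) regular_borel_measureD(3)[OF rP oW] by (rule emeasure_mono)
      also have "\<dots> = emeasure Q (\<Union>W)"
        using radon_product_measure_eq_pair_measure[OF M N P WV]
          radon_product_measure_eq_pair_measure[OF M N Q WV] by simp
      also have "\<dots> \<le> emeasure Q U"
        using W(4) regular_borel_measureD(3)[OF rQ U] by (rule emeasure_mono)
      finally show ?thesis .
    qed
    moreover have "emeasure P U = (SUP K\<in>{K. compactin ?X K \<and> K \<subseteq> U}. emeasure P K)"
      using rP U unfolding regular_borel_measure_def by blast
    ultimately show ?thesis by (auto intro: SUP_least)
  qed
  have rP: "regular_borel_measure ?X P" and rQ: "regular_borel_measure ?X Q"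
    using P Q by (auto simp: radon_product_measure_def)
  have op: "emeasure P U = emeasure Q U" if "openin ?X U" for U
    using le[OF P Q that] le[OF Q P that] by (rule antisym)
  show ?thesis
  proof (rule measure_eqI)
    show s: "sets P = sets Q"
      using regular_borel_measureD(1)[OF rP] regular_borel_measureD(1)[OF rQ] by simp
    fix A assume A: "A \<in> sets P"
    have "emeasure P A = (INF U\<in>{U. openin ?X U \<and> A \<subseteq> U}. emeasure P U)"
      using rP A unfolding regular_borel_measure_def by blast
    also have "\<dots> = (INF U\<in>{U. openin ?X U \<and> A \<subseteq> U}. emeasure Q U)"
      by (rule INF_cong) (auto simp: op)
    also have "\<dots> = emeasure Q A"
      using rQ A s unfolding regular_borel_measure_def by metis
    finally show "emeasure P A = emeasure Q A" .
  qed
qed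

lemma homeomorphic_maps_measurable:
  assumes P: "regular_borel_measure X P" and f: "homeomorphic_maps X X f g"
  shows "f \<in> P \<rightarrow>\<^sub>M P"
proof (rule measurable_sigma_sets[OF regular_borel_measureD(1)[OF P]])
  note P' = regular_borel_measureD[OF P]
  have cf: "continuous_map X X f" using f by (auto simp: homeomorphic_maps_def)
  show "{U. openin X U} \<subseteq> Pow (topspace X)" by (auto dest: openin_subset)
  show "f \<in> space P \<rightarrow> topspace X" unfolding P'(2) by (rule continuous_map_funspace[OF cf])
  fix U assume "U \<in> {U. openin X U}"
  then have "openin X {x \<in> topspace X. f x \<in> U}"
    using cf by (auto simp: continuous_map_def)
  moreover have "f -` U \<inter> space P = {x \<in> topspace X. f x \<in> U}" using P'(2) by auto
  ultimately show "f -` U \<inter> space P \<in> sets P" using P'(3) by auto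
qed

lemma regular_borel_measure_distr:
  assumes P: "regular_borel_measure X P" and f: "homeomorphic_maps X X f g"
  shows "regular_borel_measure X (distr P P f)"
proof -
  note P' = regular_borel_measureD[OF P]
  have cf: "continuous_map X X f" and cg: "continuous_map X X g"
    and gf: "\<And>x. x \<in> topspace X \<Longrightarrow> g (f x) = x" and fg: "\<And>x. x \<in> topspace X \<Longrightarrow> f (g x) = x"
    using f by (auto simp: homeomorphic_maps_def)
  have gX: "g x \<in> topspace X" if "x \<in> topspace X" for x
    using cg that continuous_map_funspace by fastforce
  have fX: "f x \<in> topspace X" if "x \<in> topspace X" for x
    using cf that continuous_map_funspace by fastforce
  have gm: "g \<in> P \<rightarrow>\<^sub>M P"
    using P f by (metis homeomorphic_maps_measurable homeomorphic_maps_sym)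
  have fm: "f \<in> P \<rightarrow>\<^sub>M P" by (rule homeomorphic_maps_measurable[OF P f])
  have vg: "f -` A \<inter> topspace X = g ` A" if "A \<subseteq> topspace X" for A
    using that gX fX gf fg by (auto simp: subset_iff image_iff) metis
  have vf: "g -` A \<inter> topspace X = f ` A" if "A \<subseteq> topspace X" for A
    using that gX fX gf fg by (auto simp: subset_iff image_iff) metis
  have fgi: "f ` g ` A = A" "g ` f ` A = A" if "A \<subseteq> topspace X" for A
    using that fg gf by (auto simp: image_iff subset_iff) (metis+)?
  have e: "emeasure (distr P P f) A = emeasure P (g ` A)" if "A \<in> sets P" for A
    using emeasure_distr[OF fm that] vg[of A] sets.sets_into_space[OF that] P'(2) by simp
  have gs: "g ` A \<in> sets P" if "A \<in> sets P" for A
    using measurable_sets[OF fm that] vg[of A] sets.sets_into_space[OF that] P'(2) by simp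
  have hf: "homeomorphic_map X X f" "homeomorphic_map X X g"
    using f by (metis homeomorphic_maps_map)+
  have of': "openin X (f ` U)" if "openin X U" for U
    using hf(1) homeomorphic_map_openness_eq openin_subset that by metis
  have og: "openin X (g ` U)" if "openin X U" for U
    using hf(2) homeomorphic_map_openness_eq openin_subset that by metis
  have kf: "compactin X (f ` K)" "compactin X (g ` K)" if "compactin X K" for K
    using that cf cg image_compactin by blast+
  have eK: "emeasure (distr P P f) K \<le> emeasure P (g ` K)" if "compactin X K" for K
  proof (cases "K \<in> sets P")
    case True then show ?thesis by (simp add: e)
  next
    case False then show ?thesis by (simp add: emeasure_notin_sets)
  qed
  show ?thesis
    unfolding regular_borel_measure_def
  proof (intro conjI allI impI ballI)
    show "sets (distr P P f) = sigma_sets (topspace X) {U. openin X U}" using P'(1) by simp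
  next
    fix K assume K: "compactin X K"
    then have "emeasure P (g ` K) < \<infinity>"
      using P kf unfolding regular_borel_measure_def by blast
    then show "emeasure (distr P P f) K < \<infinity>" using eK[OF K] by (rule le_less_trans[rotated])
  next
    fix A assume "A \<in> sets (distr P P f)"
    then have A: "A \<in> sets P" by simp
    have AX: "A \<subseteq> topspace X" using sets.sets_into_space[OF A] P'(2) by simp
    have "emeasure (distr P P f) A = (INF U\<in>{U. openin X U \<and> g ` A \<subseteq> U}. emeasure P U)"
      using P gs[OF A] e[OF A] unfolding regular_borel_measure_def by metis
    also have "{U. openin X U \<and> g ` A \<subseteq> U} = (`) g ` {U. openin X U \<and> A \<subseteq> U}" (is "?L = ?R")
    proof
      show "?R \<subseteq> ?L" using og by auto
      show "?L \<subseteq> ?R"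
      proof
        fix U assume "U \<in> ?L"
        then have U: "openin X U" "g ` A \<subseteq> U" by auto
        then have "A \<subseteq> f ` U" using fgi(1)[OF AX] by blast
        moreover have "U = g ` f ` U" using fgi(2) openin_subset[OF U(1)] by metis
        ultimately show "U \<in> ?R" using of'[OF U(1)] by blast
      qed
    qed
    also have "(INF U\<in>\<dots>. emeasure P U) = (INF U\<in>{U. openin X U \<and> A \<subseteq> U}. emeasure P (g ` U))"
      by (simp add: image_image)
    also have "\<dots> = (INF U\<in>{U. openin X U \<and> A \<subseteq> U}. emeasure (distr P P f) U)"
      by (rule INF_cong) (auto simp: e P'(3))
    finally show "emeasure (distr P P f) A =
        (INF U\<in>{U. openin X U \<and> A \<subseteq> U}. emeasure (distr P P f) U)" .
  next
    fix U assume U: "openin X U"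
    have sgU: "emeasure P (g ` U) = (SUP K\<in>{K. compactin X K \<and> K \<subseteq> g ` U}. emeasure P K)"
      using P og[OF U] unfolding regular_borel_measure_def by blast
    show "emeasure (distr P P f) U =
        (SUP K\<in>{K. compactin X K \<and> K \<subseteq> U}. emeasure (distr P P f) K)"
    proof (rule antisym)
      show "emeasure (distr P P f) U \<le>
          (SUP K\<in>{K. compactin X K \<and> K \<subseteq> U}. emeasure (distr P P f) K)"
        unfolding e[OF P'(3)[OF U]] sgU
      proof (rule SUP_mono)
        fix K assume "K \<in> {K. compactin X K \<and> K \<subseteq> g ` U}"
        then have K: "compactin X K" "K \<subseteq> g ` U" by auto
        have KX: "K \<subseteq> topspace X" by (rule compactin_subset_topspace[OF K(1)])
        have "f ` K \<subseteq> U" using K(2) fgi(1)[OF openin_subset[OF U]] by blast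
        moreover have "emeasure P K \<le> emeasure (distr P P f) (f ` K)"
        proof (cases "K \<in> sets P")
          case True
          have "f ` K \<in> sets P"
            using measurable_sets[OF gm True] vf[OF KX] P'(2) by simp
          then show ?thesis using e fgi(2)[OF KX] by simp
        qed (simp add: emeasure_notin_sets)
        ultimately show "\<exists>L\<in>{K. compactin X K \<and> K \<subseteq> U}.
            emeasure P K \<le> emeasure (distr P P f) L"
          using kf(1)[OF K(1)] by blast
      qed
      show "(SUP K\<in>{K. compactin X K \<and> K \<subseteq> U}. emeasure (distr P P f) K) \<le>
          emeasure (distr P P f) U"
        by (rule SUP_least) (auto intro!: emeasure_mono simp: P'(3) U)
    qed
  qed
qed

context compact_group
begin

lemma homeomorphic_maps_translation:
  assumes "a \<in> carrier G"
  shows "homeomorphic_maps T T (\<lambda>x. a \<otimes> x) (\<lambda>x. inv a \<otimes> x)"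
proof -
  have c: "continuous_map T T (\<lambda>x. b \<otimes> x)" if "b \<in> carrier G" for b
  proof -
    have "continuous_map T (prod_topology T T) (\<lambda>x. (b, x))"
      using that by (simp add: continuous_map_paired topspace_eq)
    then have "continuous_map T T ((\<lambda>(x, y). x \<otimes> y) \<circ> (\<lambda>x. (b, x)))"
      using continuous_mult by (rule continuous_map_compose)
    then show ?thesis by (simp add: o_def)
  qed
  show ?thesis using assms c
    by (auto simp: homeomorphic_maps_def topspace_eq m_assoc[symmetric])
qed

theorem normalized_haar_measure_product:
  assumes N: "normalized_haar_measure G T N" and P: "radon_product_measure T N T N P"
  shows "normalized_haar_measure (G \<times>\<times> G) (prod_topology T T) P"
proof -
  let ?X = "prod_topology T T"
  have rN: "regular_borel_measure T N" using N by (simp add: normalized_haar_measure_def)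
  have rP: "regular_borel_measure ?X P" using P by (simp add: radon_product_measure_def)
  note N' = regular_borel_measureD[OF rN] and P' = regular_borel_measureD[OF rP]
  have N1: "emeasure N (carrier G) = 1" using N by (simp add: normalized_haar_measure_def)
  have cN: "carrier G \<in> sets N" using N'(2) topspace_eq by (metis sets.top)
  have fin: "finite_measure N"
    by (rule finite_measureI) (use N1 N'(2) topspace_eq in simp)
  have inv: "emeasure P (p <#\<^bsub>G \<times>\<times> G\<^esub> E) = emeasure P E"
    if p: "p \<in> carrier (G \<times>\<times> G)" and E: "E \<in> sets P" for p E
  proof -
    obtain a b where ab: "p = (a, b)" "a \<in> carrier G" "b \<in> carrier G" using p by (cases p) auto
    define f where "f = (\<lambda>(x, y). (inv a \<otimes> x, inv b \<otimes> y))"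
    define g where "g = (\<lambda>(x, y). (a \<otimes> x, b \<otimes> y))"
    have fg: "homeomorphic_maps ?X ?X f g"
      unfolding f_def g_def homeomorphic_maps_prod
      using homeomorphic_maps_translation[OF inv_closed[OF ab(2)]]
        homeomorphic_maps_translation[OF inv_closed[OF ab(3)]] ab by simp
    note fm = homeomorphic_maps_measurable[OF rP fg]
    have dist: "emeasure (distr P P f) A = emeasure P (g ` A)" if A: "A \<in> sets P" for A
    proof -
      have AG: "A \<subseteq> carrier G \<times> carrier G"
        using sets.sets_into_space[OF A] P'(2) topspace_eq by simp
      have inverse: "f (g q) = q" "g (f q) = q" "g q \<in> carrier G \<times> carrier G"
        if "q \<in> carrier G \<times> carrier G" for q
        using that ab by (auto simp: f_def g_def m_assoc[symmetric])
      have "f -` A \<inter> (carrier G \<times> carrier G) = g ` A"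
      proof (intro subset_antisym subsetI)
        fix q assume q: "q \<in> f -` A \<inter> (carrier G \<times> carrier G)"
        then have "q = g (f q)" by (intro inverse(2)[symmetric]) (rule IntD2)
        then show "q \<in> g ` A" using q by (intro image_eqI[of _ _ "f q"]) (auto simp only: vimage_eq Int_iff)
      next
        fix q assume "q \<in> g ` A"
        then obtain r where r: "q = g r" "r \<in> A" by (rule imageE)
        then have "r \<in> carrier G \<times> carrier G" using AG by (rule_tac subsetD)
        then have "f q = r" "q \<in> carrier G \<times> carrier G" using r(1) inverse by simp_all
        then show "q \<in> f -` A \<inter> (carrier G \<times> carrier G)"
          using r(2) by (simp only: vimage_eq Int_iff)
      qed
      then have "f -` A \<inter> space P = g ` A" using P'(2) topspace_eq by simp
      then show ?thesis by (simp add: emeasure_distr[OF fm A])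
    qed
    have "radon_product_measure T N T N (distr P P f)"
      unfolding radon_product_measure_def
    proof (intro conjI ballI)
      show "regular_borel_measure ?X (distr P P f)"
        by (rule regular_borel_measure_distr[OF rP fg])
      fix A B assume A: "A \<in> sets N" and B: "B \<in> sets N"
      have tr: "c <# C \<in> sets N" "emeasure N (c <# C) = emeasure N C"
        if c: "c \<in> carrier G" and C: "C \<in> sets N" for c C
      proof -
        have m: "(\<lambda>x. inv c \<otimes> x) \<in> N \<rightarrow>\<^sub>M N"
          using homeomorphic_maps_translation[OF inv_closed[OF c]]
          by (rule homeomorphic_maps_measurable[OF rN])
        have CG: "C \<subseteq> carrier G" using sets.sets_into_space[OF C] N'(2) topspace_eq by simp
        have "(\<lambda>x. inv c \<otimes> x) -` C \<inter> space N = c <# C"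
          using c CG N'(2) topspace_eq
          by (force simp: l_coset_def m_assoc[symmetric] subset_iff)
        then show "c <# C \<in> sets N" using measurable_sets[OF m C] by simp
        show "emeasure N (c <# C) = emeasure N C"
          using N c C by (simp add: normalized_haar_measure_def)
      qed
      have "emeasure (distr P P f) (A \<times> B) = emeasure P (g ` (A \<times> B))"
        by (rule dist) (rule regular_borel_measure_Times(2)[OF rN rN rP A B])
      also have "g ` (A \<times> B) = (a <# A) \<times> (b <# B)"
        by (auto simp: g_def l_coset_def image_iff)
      also have "emeasure P \<dots> = emeasure N A * emeasure N B"
        using P tr ab A B by (simp add: radon_product_measure_def)
      finally show "emeasure (distr P P f) (A \<times> B) = emeasure N A * emeasure N B" .
    qed
    then have "distr P P f = P"
      using radon_product_measure_unique[OF rN fin rN fin _ P] by blast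
    moreover have "p <#\<^bsub>G \<times>\<times> G\<^esub> E = g ` E"
      by (auto simp: ab g_def l_coset_def image_iff mult_DirProd' split: prod.splits)
    ultimately show ?thesis using dist[OF E] by simp
  qed
  have "emeasure P (carrier (G \<times>\<times> G)) = 1"
    using P cN N1 by (simp add: radon_product_measure_def)
  then show ?thesis using rP inv by (simp add: normalized_haar_measure_def)
qed

end

end

theory Submission
  imports Defs "HOL-Algebra.Left_Coset" "HOL-Probability.Probability_Measure"
begin

text \<open>
  The set of commuting pairs is closed and its section at \<open>x\<close> is the centralizer of \<open>x\<close>, which
  has positive measure only if it has finite index, that is, if \<open>x \<in> F\<close>. So positive measure of
  the set of commuting pairs forces \<open>\<nu> F > 0\<close>, hence \<open>F\<close> has finite index. Now \<open>F\<close> is the union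
  over \<open>n\<close> of the closed sets of elements with at most \<open>n\<close> conjugates, and by Baire's theorem one
  of these contains a nonempty open set \<open>V\<close>; thus \<open>F\<close> is open.

  If \<open>F\<close> is open, choose \<open>V\<close> as before and \<open>x \<in> V\<close> with the largest number of conjugates under \<open>F\<close>,
  say \<open>b\<^sub>i x b\<^sub>i\<^sup>-\<^sup>1\<close>. For \<open>c\<close> near \<open>1\<close>, \<open>c\<close> commutes with all \<open>b\<^sub>i\<close> and \<open>cx \<in> V\<close>, so the conjugates
  of \<open>cx\<close> are exactly the \<open>c b\<^sub>i x b\<^sub>i\<^sup>-\<^sup>1\<close>. Hence the commutators of \<open>c\<close> with elements of \<open>F\<close> lie in
  a fixed finite set, and by the tube lemma they are trivial for \<open>c\<close> close enough to \<open>1\<close>.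
\<close>

section \<open>Centralizers and conjugacy classes\<close>

lemma (in group) conjugate_eq_iff:
  assumes "g \<in> carrier G" "x \<in> carrier G" "y \<in> carrier G"
  shows "g \<otimes> x \<otimes> inv g = y \<longleftrightarrow> g \<otimes> x = y \<otimes> g"
  using assms by (intro inv_solve_right') auto

lemma (in group) subgroup_stabilizer:
  assumes "x \<in> carrier G"
  shows "subgroup {g \<in> carrier G. g \<otimes> x \<otimes> inv g = x} G"
proof -
  have eq: "{g \<in> carrier G. g \<otimes> x \<otimes> inv g = x} = {g \<in> carrier G. g \<otimes> x = x \<otimes> g}"
    using conjugate_eq_iff assms by blast
  show ?thesis
    unfolding eq
  proof (rule subgroupI)
    show "{g \<in> carrier G. g \<otimes> x = x \<otimes> g} \<noteq> {}" using assms by (auto intro!: exI[of _ \<one>])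
  next
    fix a assume "a \<in> {g \<in> carrier G. g \<otimes> x = x \<otimes> g}"
    then have a: "a \<in> carrier G" "a \<otimes> x = x \<otimes> a" by auto
    have "a \<otimes> (x \<otimes> inv a) = x"
      using conjugate_eq_iff[OF a(1) assms assms] a assms by (metis inv_closed m_assoc)
    then have "inv a \<otimes> x = x \<otimes> inv a"
      using inv_solve_left' a(1) assms by (metis inv_closed m_closed)
    then show "inv a \<in> {g \<in> carrier G. g \<otimes> x = x \<otimes> g}" using a by simp
  next
    fix a b assume "a \<in> {g \<in> carrier G. g \<otimes> x = x \<otimes> g}" "b \<in> {g \<in> carrier G. g \<otimes> x = x \<otimes> g}"
    then show "a \<otimes> b \<in> {g \<in> carrier G. g \<otimes> x = x \<otimes> g}"
      using assms by simp (metis m_assoc)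
  qed auto
qed

text \<open>Conjugating \<open>x\<close> by \<open>a\<close> depends only on the left coset of
  \<open>a\<close> modulo the centralizer of \<open>x\<close>, so the class is an image of the
  finite set of cosets.\<close>

lemma (in group) finite_conjugacy_class:
  assumes x: "x \<in> carrier G" and fin: "finite (lcosets {g \<in> carrier G. g \<otimes> x \<otimes> inv g = x})"
  shows "finite (conjugacy_class G x)"
proof -
  define C where "C = {g \<in> carrier G. g \<otimes> x \<otimes> inv g = x}"
  have C: "subgroup C G" unfolding C_def using x by (rule subgroup_stabilizer)
  have "a \<otimes> x \<otimes> inv a = b \<otimes> x \<otimes> inv b"
    if ab: "a \<in> carrier G" "b \<in> carrier G" "a <# C = b <# C" for a b
  proof -
    have "a \<in> b <# C" using lcos_self[OF ab(1) C] ab by simp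
    then obtain c where c: "a = b \<otimes> c" "c \<in> carrier G" "c \<otimes> x \<otimes> inv c = x"
      by (auto simp: l_coset_def C_def)
    have "a \<otimes> x \<otimes> inv a = b \<otimes> (c \<otimes> x \<otimes> inv c) \<otimes> inv b"
      using c(1,2) ab x by (simp add: m_assoc inv_mult_group)
    then show ?thesis using c by simp
  qed
  then obtain h where h: "\<And>a. a \<in> carrier G \<Longrightarrow> a \<otimes> x \<otimes> inv a = h (a <# C)"
    using function_factors_left_gen[of "\<lambda>a. a \<in> carrier G" "\<lambda>a. a <# C" "\<lambda>a. a \<otimes> x \<otimes> inv a"]
    by blast
  have "conjugacy_class G x \<subseteq> h ` (lcosets C)"
    using h by (auto simp: conjugacy_class_def LCOSETS_def)
  then show ?thesis using fin unfolding C_def by (rule finite_surj[rotated])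
qed

text \<open>Turns the section of the commuting pairs at \<open>x\<close> into the stabilizer of
  \<open>x\<close> under conjugation, whose index controls the class of \<open>x\<close>.\<close>

lemma (in group) commutator_eq_one_iff:
  assumes "x \<in> carrier G" "y \<in> carrier G"
  shows "commutator G x y = \<one> \<longleftrightarrow> y \<otimes> x \<otimes> inv y = x"
proof -
  have "commutator G x y = \<one> \<longleftrightarrow> x \<otimes> y \<otimes> inv x = y"
    unfolding commutator_def using assms by (simp add: inv_solve_right')
  also have "\<dots> \<longleftrightarrow> y \<otimes> x \<otimes> inv y = x"
    using assms by (metis inv_solve_right m_closed)
  finally show ?thesis .
qed

lemma (in group) center_FC_center:
  "center (G\<lparr>carrier := FC_center G\<rparr>) =
    {z \<in> FC_center G. \<forall>x\<in>FC_center G. z \<otimes> x = x \<otimes> z}"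
  by (simp add: center_def)

text \<open>An intersection of subgroups: \<open>FC_center G\<close> itself and the stabilizers of
  its elements.\<close>

lemma (in group) subgroup_center_FC_center:
  "subgroup (center (G\<lparr>carrier := FC_center G\<rparr>)) G"
proof -
  have sub: "\<And>x. x \<in> FC_center G \<Longrightarrow> x \<in> carrier G" by (simp add: FC_center_def)
  have "center (G\<lparr>carrier := FC_center G\<rparr>) =
      \<Inter>(insert (FC_center G) ((\<lambda>x. {g \<in> carrier G. g \<otimes> x \<otimes> inv g = x}) ` FC_center G))"
    unfolding center_FC_center using sub by (auto simp: conjugate_eq_iff)
  also have "subgroup \<dots> G"
    by (rule subgroups_Inter) (use subgroup_FC_center subgroup_stabilizer sub in auto)
  finally show ?thesis .
qed

section \<open>Null sets for regular Borel measures and their products\<close>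

lemma emeasure_compact_finite:
  assumes "regular_borel_measure T M" "compact_space T"
  shows "emeasure M (topspace T) < \<infinity>"
  using assms unfolding regular_borel_measure_def compact_space_def by blast

lemma regular_borel_measure_small_open:
  assumes M: "regular_borel_measure T M" and A: "A \<in> null_sets M" and e: "0 < e"
  obtains U where "openin T U" "A \<subseteq> U" "emeasure M U < e"
proof -
  have "emeasure M A = (INF U\<in>{U. openin T U \<and> A \<subseteq> U}. emeasure M U)"
    using M A unfolding regular_borel_measure_def by blast
  then have "(INF U\<in>{U. openin T U \<and> A \<subseteq> U}. emeasure M U) < e" using A e by auto
  then show ?thesis using that by (auto simp: INF_less_iff)
qed

lemma regular_borel_measure_closedin:
  assumes M: "regular_borel_measure T M" and "closedin T C"
  shows "C \<in> sets M"
proof -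
  have "topspace T - C \<in> sets M" using assms regular_borel_measureD(3)[OF M] by blast
  then have "space M - (topspace T - C) \<in> sets M" by auto
  moreover have "space M - (topspace T - C) = C"
    using closedin_subset[OF assms(2)] regular_borel_measureD(2)[OF M] by auto
  ultimately show ?thesis by simp
qed

text \<open>
  This replaces Fubini's theorem, which is not available for closed sets outside the product
  \<open>\<sigma>\<close>-algebra: a compact set with null sections is covered, up to a strip of small measure,
  by finitely many thin tubes.
\<close>

lemma radon_product_measure_null_sections:
  assumes M: "regular_borel_measure S M" and N: "regular_borel_measure T N"
    and P: "radon_product_measure S M T N P"
    and S: "compact_space S" and T: "compact_space T"
    and K: "closedin (prod_topology S T) K" and Z: "Z \<in> null_sets M"
    and sec: "\<And>x. x \<in> topspace S - Z \<Longrightarrow> emeasure N {y \<in> topspace T. (x, y) \<in> K} = 0"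
  shows "emeasure P K = 0"
proof -
  let ?X = "prod_topology S T" and ?S = "topspace S" and ?T = "topspace T"
  have rP: "regular_borel_measure ?X P" using P by (simp add: radon_product_measure_def)
  have KP: "K \<in> sets P" by (rule regular_borel_measure_closedin[OF rP K])
  have KX: "K \<subseteq> ?S \<times> ?T" using closedin_subset[OF K] by simp
  note rect = regular_borel_measure_Times(2)[OF M N rP]
  have TN: "?T \<in> sets N" using regular_borel_measureD(3)[OF N] by blast
  have prodP: "emeasure P (A \<times> B) = emeasure M A * emeasure N B"
    if "A \<in> sets M" "B \<in> sets N" for A B
    using P that by (simp add: radon_product_measure_def)
  \<comment> \<open>The summand \<open>e * emeasure N ?T\<close> pays for a strip over a small open
    \<open>Q\<close> containing \<open>Z\<close>, and \<open>e * emeasure M ?S\<close> for finitely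
    many tubes over the rest.\<close>
  have bound: "emeasure P K \<le> e * emeasure N ?T + e * emeasure M ?S" if e: "0 < e" for e
  proof -
    obtain Q where Q: "openin S Q" "Z \<subseteq> Q" "emeasure M Q < e"
      using regular_borel_measure_small_open[OF M Z e] .
    have "\<exists>U V. openin S U \<and> x \<in> U \<and> V \<in> sets N \<and> emeasure N V < e \<and>
        K \<inter> (U \<times> ?T) \<subseteq> U \<times> V" if x: "x \<in> ?S - Q" for x
    proof -
      have "continuous_map T ?X (\<lambda>y. (x, y))" using x by (simp add: continuous_map_paired)
      then have "closedin T {y \<in> ?T. (x, y) \<in> K}"
        using K by (rule closedin_continuous_map_preimage)
      then have "{y \<in> ?T. (x, y) \<in> K} \<in> null_sets N"
        using sec[of x] x Q(2) regular_borel_measure_closedin[OF N] by auto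
      then obtain V where V: "openin T V" "{y \<in> ?T. (x, y) \<in> K} \<subseteq> V" "emeasure N V < e"
        using regular_borel_measure_small_open[OF N _ e] by blast
      \<comment> \<open>\<open>?W\<close> is open and contains the whole fibre over
        \<open>x\<close>, because the section at \<open>x\<close> lies in \<open>V\<close>. The tube
        lemma yields a neighbourhood \<open>U\<close> of \<open>x\<close> over which
        \<open>K\<close> stays inside \<open>U \<times> V\<close>.\<close>
      let ?W = "(topspace ?X - K) \<union> (?S \<times> V)"
      have W: "openin ?X ?W"
        using K V(1) by (intro openin_Un) (auto simp: openin_prod_Times_iff)
      have cT: "compactin T ?T" using T by (simp add: compact_space_def)
      obtain U V' where U: "openin S U" "x \<in> U" "?T \<subseteq> V'" "U \<times> V' \<subseteq> ?W"
        using tube_lemma_right[OF W cT, of x] x V(2) by auto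
      have "K \<inter> (U \<times> ?T) \<subseteq> U \<times> V" using U KX by blast
      then show ?thesis using U(1,2) V regular_borel_measureD(3)[OF N] by blast
    qed
    then obtain U V where UV: "\<And>x. x \<in> ?S - Q \<Longrightarrow> openin S (U x) \<and> x \<in> U x \<and> V x \<in> sets N \<and>
        emeasure N (V x) < e \<and> K \<inter> (U x \<times> ?T) \<subseteq> U x \<times> V x"
      by metis
    have "compactin S (?S - Q)" using S Q(1) by (intro closedin_compact_space) auto
    moreover have "\<And>W. W \<in> U ` (?S - Q) \<Longrightarrow> openin S W" using UV by blast
    moreover have "?S - Q \<subseteq> \<Union>(U ` (?S - Q))" using UV by blast
    ultimately obtain F where F: "finite F" "F \<subseteq> U ` (?S - Q)" "?S - Q \<subseteq> \<Union>F"
      using compactinD[of S "?S - Q" "U ` (?S - Q)"] by blast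
    then obtain I where I: "finite I" "I \<subseteq> ?S - Q" "F = U ` I"
      by (meson finite_subset_image)
    have UM: "U x \<in> sets M" if "x \<in> ?S - Q" for x
      using UV[OF that] regular_borel_measureD(3)[OF M] by blast
    have tubes: "emeasure P (K \<inter> (\<Union>(U ` I) \<times> ?T)) \<le> e * emeasure M (\<Union>(U ` I))"
      using I(1,2)
    proof (induction I rule: finite_induct)
      case (insert x J)
      \<comment> \<open>Only the part \<open>?B\<close> of the new base that earlier tubes miss is
        charged. The pieces are then disjoint and their measures add up, so overlaps are not counted
        twice.\<close>
      let ?A = "\<Union>(U ` J)" and ?B = "U x - \<Union>(U ` J)"
      have A: "?A \<in> sets M" using insert UM by (intro sets.finite_UN) auto
      then have B: "?B \<in> sets M" using insert UM by auto
      have xV: "V x \<in> sets N" "emeasure N (V x) \<le> e" "K \<inter> (U x \<times> ?T) \<subseteq> U x \<times> V x"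
        using UV[of x] insert by (auto simp: less_imp_le)
      have "K \<inter> (\<Union>(U ` insert x J) \<times> ?T) \<subseteq> (K \<inter> (?A \<times> ?T)) \<union> (?B \<times> V x)"
        using xV(3) by auto
      then have "emeasure P (K \<inter> (\<Union>(U ` insert x J) \<times> ?T)) \<le>
          emeasure P ((K \<inter> (?A \<times> ?T)) \<union> (?B \<times> V x))"
        using KP rect A B TN xV by (intro emeasure_mono) auto
      also have "\<dots> \<le> emeasure P (K \<inter> (?A \<times> ?T)) + emeasure P (?B \<times> V x)"
        using KP rect A B TN xV by (intro emeasure_subadditive) auto
      also have "\<dots> \<le> e * emeasure M ?A + e * emeasure M ?B"
        using insert.IH insert.prems prodP[OF B xV(1)] xV(2)
        by (intro add_mono) (auto simp: mult.commute[of e] intro: mult_left_mono)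
      also have "\<dots> = e * emeasure M (?A \<union> ?B)"
        using A B by (subst plus_emeasure[symmetric]) (auto simp: distrib_left)
      also have "?A \<union> ?B = \<Union>(U ` insert x J)" by auto
      finally show ?case .
    qed simp
    have UI: "\<Union>(U ` I) \<in> sets M" using I UM by (intro sets.finite_UN) auto
    have QM: "Q \<in> sets M" using Q(1) by (rule regular_borel_measureD(3)[OF M])
    have "K \<subseteq> (Q \<times> ?T) \<union> (K \<inter> (\<Union>(U ` I) \<times> ?T))" using KX F(3) I(3) by auto
    then have "emeasure P K \<le> emeasure P ((Q \<times> ?T) \<union> (K \<inter> (\<Union>(U ` I) \<times> ?T)))"
      using KP rect UI QM TN by (intro emeasure_mono) auto
    also have "\<dots> \<le> emeasure P (Q \<times> ?T) + emeasure P (K \<inter> (\<Union>(U ` I) \<times> ?T))"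
      using KP rect UI QM TN by (intro emeasure_subadditive) auto
    also have "\<dots> \<le> e * emeasure N ?T + e * emeasure M ?S"
    proof (intro add_mono)
      show "emeasure P (Q \<times> ?T) \<le> e * emeasure N ?T"
        using Q(3) by (simp add: prodP[OF QM TN] mult_right_mono)
      have "emeasure M (\<Union>(U ` I)) \<le> emeasure M ?S"
        using emeasure_space[of M] regular_borel_measureD(2)[OF M] by simp
      then show "emeasure P (K \<inter> (\<Union>(U ` I) \<times> ?T)) \<le> e * emeasure M ?S"
        using tubes by (meson mult_left_mono order_trans zero_le)
    qed
    finally show ?thesis .
  qed
  \<comment> \<open>Take \<open>e = 1/(n+1)\<close>; finiteness of \<open>c\<close>, from
    compactness, makes the bound tend to \<open>0\<close>.\<close>
  define c where "c = emeasure N ?T + emeasure M ?S"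
  have "c < \<infinity>"
    using emeasure_compact_finite[OF M S] emeasure_compact_finite[OF N T] by (simp add: c_def)
  have le: "emeasure P K \<le> ennreal (inverse (real (Suc n))) * c" for n
    using bound[of "ennreal (inverse (real (Suc n)))"] by (simp add: c_def distrib_left)
  have "(\<lambda>n. ennreal (inverse (real (Suc n))) * c) \<longlonglongrightarrow> ennreal 0 * c"
    using \<open>c < \<infinity>\<close> by (intro tendsto_mult_ennreal tendsto_ennrealI LIMSEQ_inverse_real_of_nat) auto
  then have "emeasure P K \<le> ennreal 0 * c"
    by (rule LIMSEQ_le_const) (use le in blast)
  then show ?thesis by simp
qed

section \<open>Translations, open subgroups and coverings\<close>

context compact_group
begin

lemma continuous_map_mult:
  assumes "continuous_map X T f" "continuous_map X T g"
  shows "continuous_map X T (\<lambda>x. f x \<otimes> g x)"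
proof -
  have "continuous_map X (prod_topology T T) (\<lambda>x. (f x, g x))"
    using assms by (simp add: continuous_map_paired)
  then have "continuous_map X T ((\<lambda>(x, y). x \<otimes> y) \<circ> (\<lambda>x. (f x, g x)))"
    using continuous_mult by (rule continuous_map_compose)
  then show ?thesis by (simp add: o_def)
qed

lemma continuous_map_m_inv:
  assumes "continuous_map X T f"
  shows "continuous_map X T (\<lambda>x. inv (f x))"
  using continuous_map_compose[OF assms continuous_inv] by (simp add: o_def)

lemma continuous_map_constant: "g \<in> carrier G \<Longrightarrow> continuous_map X T (\<lambda>x. g)"
  by (simp add: topspace_eq)

lemma continuous_map_identity: "continuous_map T T (\<lambda>x. x)"
  using continuous_map_id by (simp add: id_def)

lemmas continuous_map_rules = topspace_eq continuous_map_mult continuous_map_m_inv continuous_map_constant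
  continuous_map_identity continuous_map_fst continuous_map_snd

lemma l_coset_eq_image: "g <# A = (\<lambda>x. g \<otimes> x) ` A"
  by (auto simp: l_coset_def)

lemma homeomorphic_map_translation:
  "g \<in> carrier G \<Longrightarrow> homeomorphic_map T T (\<lambda>x. g \<otimes> x)"
  using homeomorphic_maps_translation homeomorphic_maps_map by blast

lemma openin_l_coset: "g \<in> carrier G \<Longrightarrow> openin T U \<Longrightarrow> openin T (g <# U)"
  unfolding l_coset_eq_image
  using homeomorphic_map_openness_eq[OF homeomorphic_map_translation] openin_subset by blast

lemma closedin_l_coset: "g \<in> carrier G \<Longrightarrow> closedin T U \<Longrightarrow> closedin T (g <# U)"
  unfolding l_coset_eq_image
  using homeomorphic_map_closedness_eq[OF homeomorphic_map_translation] closedin_subset by blast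

text \<open>Every \<open>h\<close> in \<open>H\<close> has the neighbourhood
  \<open>(h \<otimes> inv u) <# U\<close> inside \<open>H\<close>, an open translate of
  \<open>U\<close>.\<close>

lemma subgroup_openin:
  assumes H: "subgroup H G" and U: "openin T U" "U \<subseteq> H" "u \<in> U"
  shows "openin T H"
proof (subst openin_subopen, intro ballI)
  interpret H: subgroup H G by (rule H)
  fix h assume h: "h \<in> H"
  have u: "u \<in> H" using U by blast
  have "openin T ((h \<otimes> inv u) <# U)" using h u U by (intro openin_l_coset) auto
  moreover have "h = h \<otimes> inv u \<otimes> u" using h u by (simp add: m_assoc)
  then have "h \<in> (h \<otimes> inv u) <# U" using U(3) by (auto simp: l_coset_def)
  moreover have "(h \<otimes> inv u) <# U \<subseteq> H" using h u U(2) by (auto simp: l_coset_def)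
  ultimately show "\<exists>V. openin T V \<and> h \<in> V \<and> V \<subseteq> H" by blast
qed

text \<open>The complement is the union of the other left cosets, each open as a translate of
  \<open>H\<close>.\<close>

lemma subgroup_closedin:
  assumes H: "subgroup H G" and op: "openin T H"
  shows "closedin T H"
proof -
  have "\<Union>(lcosets H - {H}) = carrier G - H"
  proof -
    have "H \<in> lcosets H"
      using lcos_mult_one[OF subgroup.subset[OF H]] by (auto simp: LCOSETS_def)
    then have "A \<inter> H = {}" if "A \<in> lcosets H - {H}" for A
      using lcos_disjoint[OF H] that by blast
    then have "\<Union>(lcosets H - {H}) = \<Union>(lcosets H) - H" by blast
    then show ?thesis by (simp add: lcosets_part_G[OF H])
  qed
  moreover have "openin T (\<Union>(lcosets H - {H}))"
    using op by (intro openin_Union) (auto simp: LCOSETS_def openin_l_coset)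
  ultimately show ?thesis
    using subgroup.subset[OF H] by (simp add: closedin_def topspace_eq)
qed

lemma open_cover_translates:
  assumes U: "openin T U" and u: "u \<in> U"
  obtains R where "finite R" "R \<subseteq> carrier G" "carrier G = (\<Union>g\<in>R. g <# U)"
proof -
  have uG: "u \<in> carrier G" using openin_subset[OF U] u by (auto simp: topspace_eq)
  have "compactin T (carrier G)" using compact by (simp add: compact_space_def topspace_eq)
  moreover have "\<And>W. W \<in> (\<lambda>g. g <# U) ` carrier G \<Longrightarrow> openin T W"
    using U openin_l_coset by blast
  moreover have "carrier G \<subseteq> \<Union>((\<lambda>g. g <# U) ` carrier G)"
  proof
    fix g assume g: "g \<in> carrier G"
    then have "g = g \<otimes> inv u \<otimes> u" using uG by (simp add: m_assoc)
    then have "g \<in> (g \<otimes> inv u) <# U" using u by (auto simp: l_coset_def)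
    then show "g \<in> \<Union>((\<lambda>g. g <# U) ` carrier G)"
      using g uG by (intro UN_I[of "g \<otimes> inv u"]) auto
  qed
  ultimately obtain F where "finite F" "F \<subseteq> (\<lambda>g. g <# U) ` carrier G" "carrier G \<subseteq> \<Union>F"
    using compactinD[of T "carrier G" "(\<lambda>g. g <# U) ` carrier G"] by blast
  then obtain R where R: "finite R" "R \<subseteq> carrier G" "carrier G \<subseteq> (\<Union>g\<in>R. g <# U)"
    by (metis finite_subset_image)
  moreover have "(\<Union>g\<in>R. g <# U) \<subseteq> carrier G"
    using R(2) openin_subset[OF U] by (auto simp: l_coset_def topspace_eq)
  ultimately show ?thesis using that by blast
qed

section \<open>Baire category and bounded conjugacy classes\<close>

text \<open>\<open>G\<close> is covered by finitely many translates of \<open>H\<close>, hence by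
  countably many closed translates of the \<open>A n\<close>. Translations preserve interiors, so if
  every \<open>A n\<close> had empty interior, Baire's theorem would make \<open>G\<close>
  empty.\<close>

lemma finite_index_Baire:
  assumes H: "subgroup H G" and fin: "finite (lcosets H)"
    and A: "\<And>n::nat. closedin T (A n)" and HA: "H \<subseteq> (\<Union>n. A n)"
  obtains n where "T interior_of A n \<noteq> {}"
proof (rule ccontr)
  assume "\<not> thesis"
  then have emp: "T interior_of A n = {}" for n using that by blast
  have "lcosets H = (\<lambda>a. a <# H) ` carrier G" by (auto simp: LCOSETS_def)
  then obtain R where R: "finite R" "R \<subseteq> carrier G" "lcosets H = (\<lambda>a. a <# H) ` R"
    using fin by (metis finite_subset_image order_refl)
  define \<G> where "\<G> = (\<lambda>(g, n). g <# A n) ` (R \<times> UNIV)"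
  have "T interior_of \<Union>\<G> = {}"
  proof (rule Baire_category_alt)
    show "completely_metrizable_space T \<or> locally_compact_space T \<and> regular_space T"
      using compact Hausdorff
      by (simp add: compact_imp_locally_compact_space compact_Hausdorff_imp_regular_space)
    show "countable \<G>" using R(1) by (simp add: \<G>_def countable_finite)
    fix B assume "B \<in> \<G>"
    then obtain g n where B: "B = g <# A n" and g: "g \<in> carrier G" using R by (auto simp: \<G>_def)
    have AG: "A n \<subseteq> carrier G" using closedin_subset[OF A] topspace_eq by simp
    have "T interior_of B = {}"
    proof (rule ccontr)
      assume ne: "T interior_of B \<noteq> {}"
      have "inv g <# (T interior_of B) \<subseteq> inv g <# B"
        using interior_of_subset[of T B] by (auto simp: l_coset_def)
      also have "\<dots> = A n" using g AG by (simp add: B lcos_m_assoc lcos_mult_one)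
      finally have "inv g <# (T interior_of B) \<subseteq> T interior_of A n"
        using g by (intro interior_of_maximal openin_l_coset) auto
      then show False using emp ne by (auto simp: l_coset_def)
    qed
    then show "closedin T B \<and> T interior_of B = {}" using closedin_l_coset[OF g A] B by simp
  qed
  moreover have "\<Union>\<G> = carrier G"
  proof
    show "\<Union>\<G> \<subseteq> carrier G"
      using R(2) closedin_subset[OF A] by (auto simp: \<G>_def l_coset_def topspace_eq subset_iff)
    show "carrier G \<subseteq> \<Union>\<G>"
      using lcosets_part_G[OF H] R(3) HA by (fastforce simp: \<G>_def l_coset_def)
  qed
  ultimately have "carrier G = {}" by (metis interior_of_topspace topspace_eq)
  then show False by blast
qed

text \<open>By the pigeonhole principle, the condition says that among any \<open>n + 1\<close>
  elements of \<open>G\<close> two distinct ones conjugate \<open>x\<close> to the same element.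
  Each instance defines a finite union of equalizers of continuous maps into a Hausdorff space,
  hence a closed set.\<close>

lemma closedin_bounded_conjugacy_class:
  "closedin T {x \<in> carrier G. finite (conjugacy_class G x) \<and> card (conjugacy_class G x) \<le> n}"
    (is "closedin T ?L")
proof -
  define E where "E B = (\<Union>(g, h)\<in>B \<times> B - Id. {x \<in> carrier G. g \<otimes> x \<otimes> inv g = h \<otimes> x \<otimes> inv h})"
    for B
  let ?\<B> = "{B. B \<subseteq> carrier G \<and> finite B \<and> card B = Suc n}"
  have "closedin T {x \<in> carrier G. g \<otimes> x \<otimes> inv g = h \<otimes> x \<otimes> inv h}"
    if "g \<in> carrier G" "h \<in> carrier G" for g h
    using that closedin_continuous_maps_eq[OF Hausdorff, of T "\<lambda>x. g \<otimes> x \<otimes> inv g" "\<lambda>x. h \<otimes> x \<otimes> inv h"]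
    by (simp add: continuous_map_rules)
  then have E: "closedin T (E B)" if "B \<in> ?\<B>" for B
    unfolding E_def using that by (intro closedin_Union) auto
  have "?L = carrier G \<inter> \<Inter>(E ` ?\<B>)"
  proof (intro subset_antisym subsetI)
    fix x assume x: "x \<in> ?L"
    have "x \<in> E B" if "B \<in> ?\<B>" for B
    proof -
      have "(\<lambda>g. g \<otimes> x \<otimes> inv g) ` B \<subseteq> conjugacy_class G x"
        using that by (auto simp: conjugacy_class_def)
      then have "card ((\<lambda>g. g \<otimes> x \<otimes> inv g) ` B) \<le> n"
        using x card_mono[of "conjugacy_class G x"] by (auto intro: order_trans)
      then have "\<not> inj_on (\<lambda>g. g \<otimes> x \<otimes> inv g) B" using that card_image by fastforce
      then show ?thesis using x by (auto simp: E_def inj_on_def)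
    qed
    then show "x \<in> carrier G \<inter> \<Inter>(E ` ?\<B>)" using x by blast
  next
    fix x assume x: "x \<in> carrier G \<inter> \<Inter>(E ` ?\<B>)"
    have "finite (conjugacy_class G x) \<and> card (conjugacy_class G x) \<le> n"
    proof (rule finite_if_finite_subsets_card_bdd, rule ccontr)
      fix C assume C: "C \<subseteq> conjugacy_class G x" "finite C" "\<not> card C \<le> n"
      then obtain D where D: "D \<subseteq> C" "card D = Suc n"
        by (metis not_less_eq_eq obtain_subset_with_card_n)
      \<comment> \<open>One conjugator is chosen for each of the \<open>n + 1\<close> elements of
        \<open>D\<close>; conjugation of \<open>x\<close> is injective on the resulting
        \<open>B\<close>, contradicting \<open>x \<in> E B\<close>.\<close>
      then obtain B where B: "B \<subseteq> carrier G" "inj_on (\<lambda>g. g \<otimes> x \<otimes> inv g) B"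
          "D = (\<lambda>g. g \<otimes> x \<otimes> inv g) ` B"
        using order_trans[OF D(1) C(1)] unfolding conjugacy_class_def subset_image_inj by blast
      then have cB: "card B = Suc n" using D(2) by (simp add: card_image)
      \<comment> \<open>\<open>B\<close> is finite because an infinite set has \<open>card\<close>
        equal to \<open>0\<close>, not \<open>Suc n\<close>.\<close>
      then have "B \<in> ?\<B>" using B(1) card.infinite by fastforce
      then have "x \<in> E B" using x by blast
      then show False using B(2) by (auto simp: E_def inj_on_def)
    qed
    then show "x \<in> ?L" using x by blast
  qed
  also have "\<dots> = \<Inter>(insert (carrier G) (E ` ?\<B>))" by simp
  also have "closedin T \<dots>"
    using E closedin_topspace[of T] topspace_eq by (intro closedin_Inter) auto
  finally show ?thesis .
qed

lemma closedin_commuting_pairs: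
  "closedin (prod_topology T T) {(x, y) \<in> carrier G \<times> carrier G. commutator G x y = \<one>}"
proof -
  have "continuous_map (prod_topology T T) T (\<lambda>p. snd p \<otimes> fst p \<otimes> inv (snd p))"
    by (simp add: continuous_map_rules)
  then have "closedin (prod_topology T T)
      {p \<in> topspace (prod_topology T T). snd p \<otimes> fst p \<otimes> inv (snd p) = fst p}"
    by (intro closedin_continuous_maps_eq[OF Hausdorff]) (auto simp: continuous_map_rules)
  also have "{p \<in> topspace (prod_topology T T). snd p \<otimes> fst p \<otimes> inv (snd p) = fst p} =
      {(x, y) \<in> carrier G \<times> carrier G. commutator G x y = \<one>}"
    by (auto simp: topspace_eq commutator_eq_one_iff)
  finally show ?thesis .
qed

text \<open>The pieces are closed, so this serves both Baire's theorem and the measurability of the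
  FC-center.\<close>

lemma FC_center_eq_UN:
  "FC_center G = (\<Union>n. {x \<in> carrier G. finite (conjugacy_class G x) \<and> card (conjugacy_class G x) \<le> n})"
  by (auto simp: FC_center_def)

lemma bounded_class_open_subset:
  assumes "finite (lcosets (FC_center G))"
  obtains V n where "openin T V" "V \<noteq> {}"
    "V \<subseteq> {x \<in> FC_center G. card (conjugacy_class G x) \<le> n}"
proof -
  define A where "A n = {x \<in> carrier G. finite (conjugacy_class G x) \<and>
    card (conjugacy_class G x) \<le> n}" for n
  have "closedin T (A n)" for n unfolding A_def by (rule closedin_bounded_conjugacy_class)
  moreover have "FC_center G \<subseteq> (\<Union>n. A n)" by (simp add: A_def FC_center_eq_UN)
  ultimately obtain n where "T interior_of A n \<noteq> {}"
    using finite_index_Baire[OF subgroup_FC_center assms, of A] by blast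
  moreover have "T interior_of A n \<subseteq> {x \<in> FC_center G. card (conjugacy_class G x) \<le> n}"
    using interior_of_subset[of T "A n"] by (auto simp: A_def FC_center_def)
  ultimately show ?thesis by (rule that[OF openin_interior_of])
qed

section \<open>Openness of the center of the FC-center\<close>

text \<open>The class of \<open>x\<close> is finite, so removing its other elements from
  \<open>G\<close> leaves an open set; the stabilizer is the preimage of that set under
  \<open>\<lambda>g. g \<otimes> x \<otimes> inv g\<close>.\<close>

lemma openin_stabilizer:
  assumes "x \<in> FC_center G"
  shows "openin T {g \<in> carrier G. g \<otimes> x \<otimes> inv g = x}"
proof -
  have x: "x \<in> carrier G" and fin: "finite (conjugacy_class G x)"
    using assms by (auto simp: FC_center_def)
  have sub: "conjugacy_class G x \<subseteq> carrier G" using x by (auto simp: conjugacy_class_def)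
  have "continuous_map T T (\<lambda>g. g \<otimes> x \<otimes> inv g)" using x by (simp add: continuous_map_rules)
  moreover have "closedin T (conjugacy_class G x - {x})"
    using fin sub Hausdorff
    by (intro closedin_Hausdorff_finite) (auto simp: topspace_eq)
  then have "openin T (carrier G - (conjugacy_class G x - {x}))"
    using topspace_eq by (metis closedin_def)
  ultimately have "openin T {g \<in> topspace T. g \<otimes> x \<otimes> inv g \<in> carrier G - (conjugacy_class G x - {x})}"
    by (rule openin_continuous_map_preimage)
  also have "{g \<in> topspace T. g \<otimes> x \<otimes> inv g \<in> carrier G - (conjugacy_class G x - {x})} =
      {g \<in> carrier G. g \<otimes> x \<otimes> inv g = x}"
    using x by (auto simp: topspace_eq conjugacy_class_def)
  finally show ?thesis .
qed

lemma openin_center_FC_center: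
  assumes op: "openin T (FC_center G)" and fin: "finite (lcosets (FC_center G))"
  shows "openin T (center (G\<lparr>carrier := FC_center G\<rparr>))"
proof -
  define F where "F = FC_center G"
  have F: "subgroup F G" unfolding F_def by (rule subgroup_FC_center)
  have sub: "g \<in> carrier G" if "g \<in> F" for g using subgroup.mem_carrier[OF F that] .
  obtain V n where V: "openin T V" "V \<noteq> {}"
    "V \<subseteq> {x \<in> FC_center G. card (conjugacy_class G x) \<le> n}"
    by (rule bounded_class_open_subset[OF fin])
  \<comment> \<open>Only conjugators in \<open>F\<close> are allowed, since their stabilizers are
    open by \<open>openin_stabilizer\<close>.\<close>
  define cl where "cl x = (\<lambda>g. g \<otimes> x \<otimes> inv g) ` F" for x
  have clV: "finite (cl x) \<and> card (cl x) \<le> n" if "x \<in> V" for x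
  proof -
    have "cl x \<subseteq> conjugacy_class G x" using sub by (auto simp: cl_def conjugacy_class_def)
    moreover have "finite (conjugacy_class G x)" "card (conjugacy_class G x) \<le> n"
      using V(3) that by (auto simp: FC_center_def)
    ultimately show ?thesis by (meson card_mono finite_subset order_trans)
  qed
  \<comment> \<open>The maximum is attained because the cardinalities are bounded by
    \<open>n\<close> on \<open>V\<close>.\<close>
  obtain x where x: "x \<in> V" "\<And>y. y \<in> V \<Longrightarrow> card (cl y) \<le> card (cl x)"
  proof -
    obtain v where "v \<in> V" using V(2) by blast
    moreover have "\<forall>y. y \<in> V \<longrightarrow> card (cl y) < Suc n" using clV by (simp add: less_Suc_eq_le)
    ultimately show ?thesis
      using that ex_has_greatest_nat[of "\<lambda>y. y \<in> V" v "\<lambda>y. card (cl y)" "Suc n"] by metis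
  qed
  have xG: "x \<in> carrier G" using V(3) x(1) by (auto simp: FC_center_def)
  \<comment> \<open>\<open>B\<close> picks one conjugator for each element of \<open>cl x\<close>.
    It is therefore finite, which makes \<open>C\<close> below a finite intersection of open
    sets.\<close>
  obtain B where B: "B \<subseteq> F" "inj_on (\<lambda>g. g \<otimes> x \<otimes> inv g) B" "cl x = (\<lambda>g. g \<otimes> x \<otimes> inv g) ` B"
    using subset_image_inj[of "cl x" "\<lambda>g. g \<otimes> x \<otimes> inv g" F] unfolding cl_def by blast
  have finB: "finite B" using B clV[OF x(1)] finite_imageD by metis
  define C where "C = carrier G \<inter> (\<Inter>g\<in>B. {h \<in> carrier G. h \<otimes> g \<otimes> inv h = g})"
  have C: "openin T C"
    unfolding C_def
    using finB B(1) openin_stabilizer openin_topspace[of T] topspace_eq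
    by (intro openin_Int_Inter) (auto simp: F_def)
  have commB: "g \<otimes> c \<otimes> inv g = c" if "c \<in> C" "g \<in> B" for c g
  proof -
    have cg: "c \<in> carrier G" "g \<in> carrier G" "c \<otimes> g \<otimes> inv c = g"
      using that B(1) sub by (auto simp: C_def)
    then show ?thesis using conjugate_eq_iff by metis
  qed
  \<comment> \<open>For \<open>c\<close> in \<open>W\<close>, \<open>c\<close> commutes with
    \<open>B\<close> and \<open>c \<otimes> x\<close> stays in \<open>V\<close>, so the maximality
    of \<open>x\<close> applies to \<open>c \<otimes> x\<close>.\<close>
  define W where "W = C \<inter> {c \<in> carrier G. c \<otimes> x \<in> V}"
  have "openin T {c \<in> topspace T. c \<otimes> x \<in> V}"
    using V(1) xG by (intro openin_continuous_map_preimage[of T T]) (auto simp: continuous_map_rules)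
  then have W: "openin T W" using C by (auto simp: W_def topspace_eq)
  have oneW: "\<one> \<in> W" using x(1) xG B(1) sub by (auto simp: W_def C_def)
  \<comment> \<open>A finite set, independent of \<open>c\<close> and \<open>h\<close>, that will
    contain every \<open>inv c \<otimes> (h \<otimes> c \<otimes> inv h)\<close> with
    \<open>c \<in> W\<close> and \<open>h \<in> F\<close>.\<close>
  define S where "S = (\<lambda>(a, b). a \<otimes> inv b) ` (cl x \<times> cl x)"
  have finS: "finite S" using clV[OF x(1)] by (simp add: S_def)
  have clG: "cl x \<subseteq> carrier G" using xG sub by (auto simp: cl_def)
  have commS: "inv c \<otimes> (h \<otimes> c \<otimes> inv h) \<in> S" if c: "c \<in> W" and h: "h \<in> F" for c h
  proof -
    have cG: "c \<in> carrier G" "c \<in> C" "c \<otimes> x \<in> V" using c by (auto simp: W_def)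
    have hG: "h \<in> carrier G" using sub h by blast
    have dist: "g \<otimes> (c \<otimes> x) \<otimes> inv g = (g \<otimes> c \<otimes> inv g) \<otimes> (g \<otimes> x \<otimes> inv g)"
      if "g \<in> carrier G" for g
      using that cG(1) xG by (simp add: m_assoc) (metis inv_closed l_inv l_one m_assoc m_closed)
    have eqB: "g \<otimes> (c \<otimes> x) \<otimes> inv g = c \<otimes> (g \<otimes> x \<otimes> inv g)" if "g \<in> B" for g
      using dist[of g] commB[OF cG(2) that] that B(1) sub by auto
    have "(\<lambda>y. c \<otimes> y) ` cl x \<subseteq> cl (c \<otimes> x)"
      unfolding B(3) using eqB B(1) by (force simp: cl_def[of "c \<otimes> x"])
    moreover have "card ((\<lambda>y. c \<otimes> y) ` cl x) = card (cl x)"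
      using cG(1) clG by (auto intro!: card_image simp: inj_on_def subset_iff)
    \<comment> \<open>By maximality of \<open>x\<close>, the conjugates of \<open>cx\<close> are just the translates by \<open>c\<close> of those of \<open>x\<close>.\<close>
    ultimately have "(\<lambda>y. c \<otimes> y) ` cl x = cl (c \<otimes> x)"
      using x(2)[OF cG(3)] clV[OF cG(3)] by (intro card_seteq) auto
    moreover have "h \<otimes> (c \<otimes> x) \<otimes> inv h \<in> cl (c \<otimes> x)" using h by (auto simp: cl_def)
    ultimately obtain y where y: "y \<in> cl x" "h \<otimes> (c \<otimes> x) \<otimes> inv h = c \<otimes> y" by auto
    have yG: "y \<in> carrier G" using y clG by blast
    define z where "z = h \<otimes> x \<otimes> inv h"
    have z: "z \<in> cl x" "z \<in> carrier G" using h hG xG by (auto simp: z_def cl_def)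
    \<comment> \<open>Conjugation by \<open>h\<close> is multiplicative, so the conjugate of
      \<open>c\<close> is \<open>c \<otimes> y \<otimes> inv z\<close> with \<open>y\<close> and
      \<open>z\<close> both in \<open>cl x\<close>.\<close>
    have "(h \<otimes> c \<otimes> inv h) \<otimes> z = c \<otimes> y" using y(2) dist[OF hG] by (simp add: z_def)
    then have "h \<otimes> c \<otimes> inv h = c \<otimes> y \<otimes> inv z"
      using z yG cG hG by (metis inv_closed inv_solve_right m_closed)
    then have "inv c \<otimes> (h \<otimes> c \<otimes> inv h) = y \<otimes> inv z"
      using z yG cG by (simp add: m_assoc) (metis inv_closed l_inv l_one m_assoc m_closed)
    then show ?thesis using y z by (auto simp: S_def)
  qed
  define f where "f = (\<lambda>p. inv (fst p) \<otimes> (snd p \<otimes> fst p \<otimes> inv (snd p)))"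
  have "continuous_map (prod_topology T T) T f"
    unfolding f_def by (simp add: continuous_map_rules)
  moreover have "S \<subseteq> carrier G" using clG by (auto simp: S_def)
  then have "closedin T (S - {\<one>})"
    using finS Hausdorff by (intro closedin_Hausdorff_finite) (auto simp: topspace_eq)
  then have "openin T (carrier G - (S - {\<one>}))"
    using topspace_eq by (metis closedin_def)
  \<comment> \<open>\<open>?O\<close> is the set of pairs at which \<open>f\<close> avoids the
    nontrivial elements of the finite set \<open>S\<close>. It contains
    \<open>{\<one>} \<times> F\<close>, where \<open>f\<close> is trivial.\<close>
  ultimately have op': "openin (prod_topology T T)
      {p \<in> topspace (prod_topology T T). f p \<in> carrier G - (S - {\<one>})}" (is "openin _ ?O")
    by (rule openin_continuous_map_preimage)
  \<comment> \<open>As an open subgroup, \<open>F\<close> is closed, hence compact, which the tube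
    lemma demands.\<close>
  have "compactin T F"
    using compact subgroup_closedin[OF F] op by (simp add: F_def closedin_compact_space)
  moreover have "{\<one>} \<times> F \<subseteq> ?O" using sub by (auto simp: f_def topspace_eq)
  ultimately obtain U U' where U: "openin T U" "\<one> \<in> U" "F \<subseteq> U'" "U \<times> U' \<subseteq> ?O"
    using tube_lemma_right[OF op', of F \<one>] by (auto simp: topspace_eq)
  define D where "D = U \<inter> W \<inter> F"
  have D: "openin T D" "\<one> \<in> D"
    using U W op oneW subgroup.one_closed[OF F] by (auto simp: D_def F_def)
  have "c \<otimes> h = h \<otimes> c" if c: "c \<in> D" and h: "h \<in> F" for c h
  proof -
    have cG: "c \<in> carrier G" "c \<in> W" and hG: "h \<in> carrier G"
      using c h sub by (auto simp: D_def)
    \<comment> \<open>On \<open>D \<times> F\<close> the values of \<open>f\<close> lie in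
      \<open>S\<close> by \<open>commS\<close> and avoid its nontrivial elements, so they equal
      \<open>\<one>\<close>.\<close>
    have "(c, h) \<in> ?O" using c h U by (auto simp: D_def)
    then have "inv c \<otimes> (h \<otimes> c \<otimes> inv h) = \<one>"
      using commS[OF cG(2) h] by (simp add: f_def)
    then have "h \<otimes> c \<otimes> inv h = c" using cG hG by (metis inv_closed inv_solve_left' m_closed r_one)
    then show ?thesis using conjugate_eq_iff[OF hG cG(1) cG(1)] by simp
  qed
  then have "D \<subseteq> center (G\<lparr>carrier := FC_center G\<rparr>)"
    unfolding center_FC_center by (auto simp: D_def F_def)
  then show ?thesis using subgroup_openin[OF subgroup_center_FC_center D(1) _ D(2)] by blast
qed

end

section \<open>Haar measure and finite index\<close>

locale compact_group_haar = compact_group +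
  fixes M :: "'a measure"
  assumes haar: "normalized_haar_measure G T M"
begin

lemma regular: "regular_borel_measure T M"
  and emeasure_carrier: "emeasure M (carrier G) = 1"
  and emeasure_l_coset: "g \<in> carrier G \<Longrightarrow> A \<in> sets M \<Longrightarrow> emeasure M (g <# A) = emeasure M A"
  using haar by (auto simp: normalized_haar_measure_def)

lemma space_eq: "space M = carrier G"
  using regular_borel_measureD(2)[OF regular] topspace_eq by simp

sublocale prob_space M
  by (rule prob_spaceI) (simp add: space_eq emeasure_carrier)

lemma sets_l_coset:
  assumes g: "g \<in> carrier G" and A: "A \<in> sets M"
  shows "g <# A \<in> sets M"
proof -
  have m: "(\<lambda>x. inv g \<otimes> x) \<in> M \<rightarrow>\<^sub>M M"
    using homeomorphic_maps_translation[OF inv_closed[OF g]]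
    by (rule homeomorphic_maps_measurable[OF regular])
  have "A \<subseteq> carrier G" using sets.sets_into_space[OF A] space_eq by simp
  then have "(\<lambda>x. inv g \<otimes> x) -` A \<inter> space M = g <# A"
    using g space_eq by (force simp: l_coset_def m_assoc[symmetric] subset_iff)
  then show ?thesis using measurable_sets[OF m A] by simp
qed

text \<open>Distinct cosets are disjoint and have the same measure as \<open>H\<close>, while the
  total mass is \<open>1\<close>; so there are at most \<open>1 / measure M H\<close> of
  them.\<close>

lemma finite_lcosets:
  assumes H: "subgroup H G" "H \<in> sets M" and pos: "0 < emeasure M H"
  shows "finite (lcosets H)"
proof -
  have m: "0 < measure M H" using pos by (simp add: emeasure_eq_measure)
  have LM: "A \<in> sets M" "measure M A = measure M H" if "A \<in> lcosets H" for A
    using that sets_l_coset emeasure_l_coset H(2) by (auto simp: LCOSETS_def measure_def)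
  have "finite (lcosets H) \<and> card (lcosets H) \<le> nat \<lfloor>1 / measure M H\<rfloor>"
  proof (rule finite_if_finite_subsets_card_bdd)
    fix K assume K: "K \<subseteq> lcosets H" "finite K"
    have "disjoint_family_on (\<lambda>A. A) K"
      using K(1) lcos_disjoint[OF H(1)] by (auto simp: disjoint_family_on_def)
    then have "measure M (\<Union>A\<in>K. A) = (\<Sum>A\<in>K. measure M A)"
      using K LM by (intro finite_measure_finite_Union) auto
    also have "\<dots> = (\<Sum>A\<in>K. measure M H)"
      using K(1) LM(2) by (intro sum.cong) auto
    finally have "real (card K) * measure M H \<le> 1" using prob_le_1 by (metis sum_constant)
    then have "real (card K) \<le> 1 / measure M H" using m by (simp add: field_simps)
    then show "card K \<le> nat \<lfloor>1 / measure M H\<rfloor>" by (simp add: le_nat_floor)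
  qed
  then show ?thesis ..
qed

text \<open>Finitely many translates of \<open>U\<close> cover \<open>G\<close>; were
  \<open>U\<close> null, they would all be null, contradicting total mass \<open>1\<close>.\<close>

lemma emeasure_open_pos:
  assumes U: "openin T U" and u: "u \<in> U"
  shows "0 < emeasure M U"
proof (rule ccontr)
  assume "\<not> 0 < emeasure M U"
  then have null: "emeasure M U = 0" by simp
  have UM: "U \<in> sets M" using U by (rule regular_borel_measureD(3)[OF regular])
  obtain R where R: "finite R" "R \<subseteq> carrier G" "carrier G = (\<Union>g\<in>R. g <# U)"
    using open_cover_translates[OF U u] .
  have "(\<Union>g\<in>R. g <# U) \<in> null_sets M"
    using R null UM sets_l_coset emeasure_l_coset
    by (intro null_sets.finite_UN) (auto simp: subset_iff)
  then show False using R(3) emeasure_carrier by auto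
qed

lemma FC_center_measurable: "FC_center G \<in> sets M"
  unfolding FC_center_eq_UN
  using regular_borel_measure_closedin[OF regular closedin_bounded_conjugacy_class] by auto

lemma finite_index_FC_center:
  assumes "openin T (FC_center G)"
  shows "finite (lcosets (FC_center G))"
  using finite_lcosets[OF subgroup_FC_center FC_center_measurable]
    emeasure_open_pos[OF assms subgroup.one_closed[OF subgroup_FC_center]] by blast

text \<open>Positive measure would give the centralizer finite index, and then \<open>x\<close>
  would have a finite class.\<close>

lemma emeasure_stabilizer:
  assumes x: "x \<in> carrier G - FC_center G"
  shows "emeasure M {g \<in> carrier G. g \<otimes> x \<otimes> inv g = x} = 0"
proof (rule ccontr)
  let ?C = "{g \<in> carrier G. g \<otimes> x \<otimes> inv g = x}"
  assume "emeasure M ?C \<noteq> 0"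
  then have "0 < emeasure M ?C" by (simp add: zero_less_iff_neq_zero)
  \<comment> \<open>A nonmeasurable set has \<open>emeasure\<close> equal to \<open>0\<close>, so
    positivity already yields measurability.\<close>
  moreover from this have "?C \<in> sets M" by (metis emeasure_notin_sets less_irrefl)
  ultimately have "finite (lcosets ?C)"
    using x by (intro finite_lcosets subgroup_stabilizer) auto
  then show False using x finite_conjugacy_class by (auto simp: FC_center_def)
qed

lemma openin_FC_center:
  assumes "0 < emeasure M (FC_center G)"
  shows "openin T (FC_center G)"
proof -
  have "finite (lcosets (FC_center G))"
    using finite_lcosets[OF subgroup_FC_center FC_center_measurable assms] .
  then obtain V n where V: "openin T V" "V \<noteq> {}"
    "V \<subseteq> {x \<in> FC_center G. card (conjugacy_class G x) \<le> n}"
    by (rule bounded_class_open_subset)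
  then obtain u where "u \<in> V" by blast
  then show ?thesis
    using V by (intro subgroup_openin[OF subgroup_FC_center V(1)]) blast+
qed

end

section \<open>Equivalence of the three conditions\<close>

theorem theorem1p2:
  fixes G :: "('a, 'b) monoid_scheme" and T :: "'a topology"
    and \<nu> :: "'a measure" and \<nu>\<nu> :: "('a \<times> 'a) measure"
  assumes "compact_group G T"
    and "normalized_haar_measure G T \<nu>"
    and "radon_product_measure T \<nu> T \<nu> \<nu>\<nu>"
  shows "(emeasure \<nu>\<nu> {(x, y) \<in> carrier G \<times> carrier G. commutator G x y = \<one>\<^bsub>G\<^esub>} > 0
            \<longleftrightarrow> openin T (FC_center G)) \<and>
         (openin T (FC_center G)
            \<longleftrightarrow> openin T (center (G\<lparr>carrier := FC_center G\<rparr>)))"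
proof -
  interpret compact_group_haar G T \<nu>
    using assms by (simp add: compact_group_haar_def compact_group_haar_axioms_def)
  let ?K = "{(x, y) \<in> carrier G \<times> carrier G. commutator G x y = \<one>\<^bsub>G\<^esub>}"
  let ?F = "FC_center G" and ?Z = "center (G\<lparr>carrier := FC_center G\<rparr>)"
  \<comment> \<open>If \<open>?F\<close> were not open it would be null, and each section over its
    complement is a centralizer of infinite index, hence null. Null sections then make
    \<open>?K\<close> null.\<close>
  have "openin T ?F" if pos: "emeasure \<nu>\<nu> ?K > 0"
  proof (rule ccontr)
    assume "\<not> openin T ?F"
    then have "emeasure \<nu> ?F = 0" using openin_FC_center by (auto simp: zero_less_iff_neq_zero)
    then have "?F \<in> null_sets \<nu>" using FC_center_measurable by auto
    moreover have "emeasure \<nu> {y \<in> topspace T. (x, y) \<in> ?K} = 0" if "x \<in> topspace T - ?F" for x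
    proof -
      have "{y \<in> topspace T. (x, y) \<in> ?K} = {g \<in> carrier G. g \<otimes>\<^bsub>G\<^esub> x \<otimes>\<^bsub>G\<^esub> inv\<^bsub>G\<^esub> g = x}"
        using that by (auto simp: topspace_eq commutator_eq_one_iff)
      then show ?thesis using emeasure_stabilizer[of x] that by (simp add: topspace_eq)
    qed
    ultimately have "emeasure \<nu>\<nu> ?K = 0"
      by (rule radon_product_measure_null_sections[OF regular regular assms(3) compact compact
            closedin_commuting_pairs])
    then show False using pos by simp
  qed
  moreover have "openin T ?Z" if "openin T ?F"
    using openin_center_FC_center[OF that finite_index_FC_center[OF that]] .
  moreover have "openin T ?F \<and> emeasure \<nu>\<nu> ?K > 0" if Z: "openin T ?Z"
  proof
    have one: "\<one>\<^bsub>G\<^esub> \<in> ?Z" by (rule subgroup.one_closed[OF subgroup_center_FC_center])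
    show "openin T ?F"
      by (rule subgroup_openin[OF subgroup_FC_center Z _ one]) (auto simp: center_FC_center)
    have rP: "regular_borel_measure (prod_topology T T) \<nu>\<nu>"
      using assms(3) by (simp add: radon_product_measure_def)
    \<comment> \<open>Elements of \<open>?Z\<close> commute with each other, and the measure of this
      rectangle is the square of the measure of the nonempty open set \<open>?Z\<close>, hence
      positive.\<close>
    have "?Z \<times> ?Z \<subseteq> ?K"
    proof
      fix p assume "p \<in> ?Z \<times> ?Z"
      then obtain x y where p: "p = (x, y)" and xy: "x \<in> ?Z" "y \<in> ?Z" by blast
      then have "x \<in> ?F" "y \<in> ?F" "y \<otimes>\<^bsub>G\<^esub> x = x \<otimes>\<^bsub>G\<^esub> y"
        unfolding center_FC_center by blast+
      moreover from this have c: "x \<in> carrier G" "y \<in> carrier G" by (simp_all add: FC_center_def)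
      ultimately have "y \<otimes>\<^bsub>G\<^esub> x \<otimes>\<^bsub>G\<^esub> inv\<^bsub>G\<^esub> y = x" using conjugate_eq_iff by blast
      then show "p \<in> ?K"
        using c p by (simp add: commutator_eq_one_iff)
    qed
    then have "emeasure \<nu>\<nu> (?Z \<times> ?Z) \<le> emeasure \<nu>\<nu> ?K"
      using regular_borel_measure_closedin[OF rP closedin_commuting_pairs] by (rule emeasure_mono)
    moreover have "0 < emeasure \<nu> ?Z" by (rule emeasure_open_pos[OF Z one])
    then have "0 < emeasure \<nu>\<nu> (?Z \<times> ?Z)"
      using assms(3) regular_borel_measureD(3)[OF regular Z]
      by (simp add: radon_product_measure_def ennreal_zero_less_mult_iff)
    ultimately show "emeasure \<nu>\<nu> ?K > 0" by (rule order_less_le_trans[rotated])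
  qed
  ultimately show ?thesis by blast
qed

end
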